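(* Let $Y$ be a graph with vertex set $[n]$. For each $\alpha\in\operatorname{Acyc}(\overline Y)$, choose a linear extension $\sigma_\alpha\in\mathcal L(\alpha)$, and let $H_\alpha$ be the connected component of $\mathsf{FS}(\mathsf{Path}_n,Y)$ containing $\sigma_\alpha$. Then the connected component $H_\alpha$ depends only on $\alpha$ (not on the specific choice of $\sigma_\alpha$), and its vertex set is $\mathcal L(\alpha)$. Moreover, \[\mathsf{FS}(\mathsf{Path}_n,Y)=\bigoplus_{\alpha\in\operatorname{Acyc}(\overline Y)}H_\alpha,\] i.e., $\mathsf{FS}(\mathsf{Path}_n,Y)$ is the disjoint union of the subgraphs $H_\alpha$, $\alpha\in\operatorname{Acyc}(\overline Y)$.
   Context: All graphs are finite and simple; $[n]=\{1,\ldots,n\}$; $\overline Y$ is the complement of $Y$. For graphs $X,Y$ with $|V(X)|=|V(Y)|$, the friends-and-strangers graph $\mathsf{FS}(X,Y)$ has as vertices all bijections $\sigma\colon V(X)\to V(Y)$; two bijections $\sigma,\sigma'$ are adjacent iff there is an edge $\{a,b\}\in E(X)$ with $\{\sigma(a),\sigma(b)\}\in E(Y)$, $\sigma(a)=\sigma'(b)$, $\sigma(b)=\sigma'(a)$, and $\sigma(c)=\sigma'(c)$ for all $c\in V(X)\setminus\{a,b\}$. When $V(X)=V(Y)=[n]$, the vertices are the permutations in $\mathfrak S_n$. $\mathsf{Path}_n$ is the graph with vertex set $[n]$ and edges $\{i,i+1\}$ for $1\le i\le n-1$. For a graph $G$ with vertex set $[n]$, $\operatorname{Acyc}(G)$ is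 the set of acyclic orientations of $G$ (orientations with no directed cycle). For $\alpha\in\operatorname{Acyc}(G)$, $\leq_\alpha$ is the partial order on $[n]$ with $i\leq_\alpha j$ iff $\alpha$ contains a directed path (possibly of length $0$) from $i$ to $j$. $\mathcal L(\alpha)$ is the set of linear extensions of $([n],\leq_\alpha)$, i.e., permutations $\sigma\in\mathfrak S_n$ such that $\sigma^{-1}(a)\leq\sigma^{-1}(b)$ whenever $a\leq_\alpha b$. *)

theory Defs
  imports "Graph_Theory.Graph_Theory" "HOL-Library.FuncSet" "HOL-Library.Disjoint_Sets"
begin

text \<open>
  A finite simple graph is a \<^locale>\<open>pair_graph\<close>: a finite, symmetric, loop-free digraph whose
  arcs are pairs of vertices. The edge \<open>{u, v}\<close> is represented by the two arcs \<open>(u, v)\<close> and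
  \<open>(v, u)\<close>.
\<close>

definition complement_graph :: "'a pair_pre_digraph \<Rightarrow> 'a pair_pre_digraph" where
  "complement_graph G = \<lparr> pverts = pverts G,
     parcs = {(u, v). u \<in> pverts G \<and> v \<in> pverts G \<and> u \<noteq> v \<and> (u, v) \<notin> parcs G} \<rparr>"

definition path_graph :: "nat \<Rightarrow> nat pair_pre_digraph" where
  "path_graph n = \<lparr> pverts = {1..n},
     parcs = {(i, j). i \<in> {1..n} \<and> j \<in> {1..n} \<and> (j = i + 1 \<or> i = j + 1)} \<rparr>"

text \<open>Functions are total, so a bijection from \<open>A\<close> to \<open>B\<close> is made unique by requiring it to be
  \<^const>\<open>undefined\<close> outside \<open>A\<close>. In particular \<open>bijections {1..n} {1..n}\<close> is the symmetric
  group on \<open>{1..n}\<close>.\<close>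

definition bijections :: "'a set \<Rightarrow> 'b set \<Rightarrow> ('a \<Rightarrow> 'b) set" where
  "bijections A B = {\<sigma> \<in> extensional A. bij_betw \<sigma> A B}"

definition FS :: "'a pair_pre_digraph \<Rightarrow> 'b pair_pre_digraph \<Rightarrow> ('a \<Rightarrow> 'b) pair_pre_digraph" where
  "FS X Y = \<lparr> pverts = bijections (pverts X) (pverts Y),
     parcs = {(\<sigma>, \<sigma>'). \<sigma> \<in> bijections (pverts X) (pverts Y) \<and> \<sigma>' \<in> bijections (pverts X) (pverts Y) \<and>
       (\<exists>a b. (a, b) \<in> parcs X \<and> (\<sigma> a, \<sigma> b) \<in> parcs Y \<and> \<sigma> a = \<sigma>' b \<and> \<sigma> b = \<sigma>' a \<and>
          (\<forall>c \<in> pverts X - {a, b}. \<sigma> c = \<sigma>' c))} \<rparr>"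

text \<open>An orientation keeps exactly one of the two arcs representing each edge.\<close>

definition orientations :: "'a pair_pre_digraph \<Rightarrow> 'a pair_pre_digraph set" where
  "orientations G = {\<alpha>. pverts \<alpha> = pverts G \<and> parcs \<alpha> \<subseteq> parcs G \<and>
     (\<forall>u v. (u, v) \<in> parcs G \<longrightarrow> ((u, v) \<in> parcs \<alpha>) \<noteq> ((v, u) \<in> parcs \<alpha>))}"

definition Acyc :: "'a pair_pre_digraph \<Rightarrow> 'a pair_pre_digraph set" where
  "Acyc G = {\<alpha> \<in> orientations G. \<nexists>p. pre_digraph.cycle (with_proj \<alpha>) p}"

definition linear_extensions :: "nat \<Rightarrow> nat pair_pre_digraph \<Rightarrow> (nat \<Rightarrow> nat) set" where
  "linear_extensions n \<alpha> = {\<sigma> \<in> bijections {1..n} {1..n}.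
     \<forall>a b. a \<rightarrow>\<^sup>*\<^bsub>with_proj \<alpha>\<^esub> b \<longrightarrow> inv_into {1..n} \<sigma> a \<le> inv_into {1..n} \<sigma> b}"

text \<open>The connected component of a graph containing a given vertex, as an induced subgraph. In a
  symmetric digraph the strongly connected components are the connected components.\<close>

definition component_of :: "'a pair_pre_digraph \<Rightarrow> 'a \<Rightarrow> ('a, 'a \<times> 'a) pre_digraph" where
  "component_of G v = induce_subgraph (with_proj G) (pre_digraph.scc_of (with_proj G) v)"

definition is_disjoint_union ::
  "('a, 'b) pre_digraph \<Rightarrow> 'i set \<Rightarrow> ('i \<Rightarrow> ('a, 'b) pre_digraph) \<Rightarrow> bool" where
  "is_disjoint_union G I H \<longleftrightarrow>
     (\<forall>i \<in> I. subgraph (H i) G) \<and> disjoint_family_on (\<lambda>i. verts (H i)) I \<and>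
     G = pre_digraph.Union G (H ` I)"

lemma pair_graph_complement_graph: "pair_graph G \<Longrightarrow> pair_graph (complement_graph G)"
proof -
  assume "pair_graph G"
  then interpret pair_graph G .
  have fin: "finite (pverts G \<times> pverts G)" by simp
  show ?thesis
    by unfold_locales
      (auto simp: complement_graph_def symmetric_def sym_def arcs_symmetric
        intro: finite_subset[OF _ fin])
qed

lemma pair_graph_path_graph: "pair_graph (path_graph n)"
proof -
  have fin: "finite ({1..n} \<times> {1..n})" by simp
  show ?thesis
    by unfold_locales
      (auto simp: path_graph_def symmetric_def sym_def intro: finite_subset[OF _ fin])
qed

lemma pair_graph_FS:
  assumes "pair_graph X" "pair_graph Y"
  shows "pair_graph (FS X Y)"
proof -
  interpret X: pair_graph X by fact
  interpret Y: pair_graph Y by fact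
  have fin: "finite (bijections (pverts X) (pverts Y))"
    by (rule finite_subset[OF _ finite_PiE[OF X.finite_verts, of "\<lambda>_. pverts Y"]])
      (auto simp: bijections_def PiE_def bij_betw_def)
  then have fin2: "finite (bijections (pverts X) (pverts Y) \<times> bijections (pverts X) (pverts Y))"
    by simp
  show ?thesis
  proof unfold_locales
    show "finite (parcs (FS X Y))"
      by (rule finite_subset[OF _ fin2]) (auto simp: FS_def)
    show "symmetric (with_proj (FS X Y))"
      unfolding symmetric_def
    proof (rule symI)
      fix \<sigma> \<sigma>' assume "(\<sigma>, \<sigma>') \<in> arcs_ends (with_proj (FS X Y))"
      then obtain a b where *: "\<sigma> \<in> bijections (pverts X) (pverts Y)"
        "\<sigma>' \<in> bijections (pverts X) (pverts Y)" "(a, b) \<in> parcs X" "(\<sigma> a, \<sigma> b) \<in> parcs Y"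
        "\<sigma> a = \<sigma>' b" "\<sigma> b = \<sigma>' a" "\<forall>c \<in> pverts X - {a, b}. \<sigma> c = \<sigma>' c"
        by (auto simp: FS_def)
      then have "(\<sigma>' a, \<sigma>' b) \<in> parcs Y"
        using Y.arcs_symmetric by auto
      with * have "(a, b) \<in> parcs X \<and> (\<sigma>' a, \<sigma>' b) \<in> parcs Y \<and> \<sigma>' a = \<sigma> b \<and> \<sigma>' b = \<sigma> a \<and>
          (\<forall>c \<in> pverts X - {a, b}. \<sigma>' c = \<sigma> c)"
        by auto
      with *(1,2) show "(\<sigma>', \<sigma>) \<in> arcs_ends (with_proj (FS X Y))"
        unfolding FS_def with_proj_simps by auto
    qed
    fix e assume "e \<in> parcs (FS X Y)"
    then show "fst e \<noteq> snd e"
      using Y.pair_no_loops by (fastforce simp: FS_def)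
  qed (use fin in \<open>auto simp: FS_def\<close>)
qed

lemma component_of_in_sccs:
  assumes "pair_graph G" "v \<in> pverts G"
  shows "component_of G v \<in> pre_digraph.sccs (with_proj G)" "v \<in> verts (component_of G v)"
proof -
  interpret pair_graph G by fact
  show "component_of G v \<in> pre_digraph.sccs (with_proj G)"
    unfolding component_of_def using scc_of_in_sccs_verts[OF assms(2)]
    by (simp add: in_sccs_verts_conv)
  show "v \<in> verts (component_of G v)"
    unfolding component_of_def using in_scc_of_self assms(2) by auto
qed

end

theory Submission
  imports Defs
begin

text \<open>
  Read a permutation \<open>\<sigma>\<close> as a queue of people, with \<open>\<sigma> i\<close> standing at place \<open>i\<close>, and orient every edge
  of the complement of \<open>Y\<close> from the person who stands earlier to the one who stands later. This
  orientation is acyclic, and \<open>\<sigma>\<close> is a linear extension of an acyclic orientation \<open>\<alpha>\<close> exactly when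
  \<open>\<alpha>\<close> is the orientation obtained from \<open>\<sigma>\<close> (\<open>linear_extensions_eq_fibre\<close>). So the sets of linear
  extensions are the fibres of one map on the symmetric group, hence pairwise disjoint and covering;
  they are nonempty because a finite acyclic relation can be sorted topologically
  (\<open>acyclic_ranking_exists\<close>).

  It remains to see that these fibres are the connected components. An edge of the
  friends-and-strangers graph exchanges two neighbours in the queue that are adjacent in \<open>Y\<close>. The
  relative order of every other pair stays the same, and the exchanged pair is no edge of the
  complement, so the orientation is an invariant of the component (\<open>FS_path_arc_preserves\<close>).
  Conversely, let \<open>\<sigma>\<close> and \<open>\<tau>\<close> give the same orientation, and sort \<open>\<sigma>\<close> into \<open>\<tau>\<close> by adjacent
  exchanges of neighbours that \<open>\<tau>\<close> has in the other order. Two people ordered differently by \<open>\<sigma>\<close> and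
  \<open>\<tau>\<close> cannot be joined in the complement, so they are adjacent in \<open>Y\<close> and the exchange is an edge of
  the friends-and-strangers graph (\<open>same_orientation_imp_reachable\<close>).
\<close>

section \<open>Orienting a graph along a ranking\<close>

definition orient_by :: "'a pair_pre_digraph \<Rightarrow> ('a \<Rightarrow> nat) \<Rightarrow> 'a pair_pre_digraph" where
  "orient_by G r = \<lparr> pverts = pverts G, parcs = {(u, v) \<in> parcs G. r u < r v} \<rparr>"

lemma orient_by_simps [simp]:
  "pverts (orient_by G r) = pverts G"
  "(u, v) \<in> parcs (orient_by G r) \<longleftrightarrow> (u, v) \<in> parcs G \<and> r u < r v"
  by (simp_all add: orient_by_def)

lemma orientation_wf:
  assumes "pair_graph G" "\<alpha> \<in> orientations G"
  shows "wf_digraph (with_proj \<alpha>)"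
proof -
  interpret pair_graph G by fact
  show ?thesis
    using assms(2) wellformed' by unfold_locales (auto simp: orientations_def)
qed

lemma orientation_eqI:
  assumes "\<alpha> \<in> orientations G" "\<beta> \<in> orientations G" "parcs \<alpha> \<subseteq> parcs \<beta>"
  shows "\<alpha> = \<beta>"
proof -
  have "parcs \<beta> \<subseteq> parcs \<alpha>"
  proof (rule subrelI)
    fix u v assume \<beta>: "(u, v) \<in> parcs \<beta>"
    then have G: "(u, v) \<in> parcs G"
      using assms(2) by (auto simp: orientations_def)
    then have "(v, u) \<notin> parcs \<beta>"
      using \<beta> assms(2) by (auto simp: orientations_def)
    then show "(u, v) \<in> parcs \<alpha>"
      using G assms(1,3) by (auto simp: orientations_def)
  qed
  with assms show ?thesis
    by (intro pair_pre_digraph.equality) (auto simp: orientations_def)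
qed

lemma orient_by_in_orientations:
  assumes "pair_graph G" "inj_on r (pverts G)"
  shows "orient_by G r \<in> orientations G"
proof -
  interpret pair_graph G by fact
  have "(v, u) \<in> parcs G \<and> r u \<noteq> r v" if "(u, v) \<in> parcs G" for u v
    using that wellformed'[OF that] pair_no_loops[OF that] assms(2)
      arcs_symmetric[OF that] by (auto dest: inj_onD)
  then show ?thesis
    unfolding orientations_def by (fastforce simp: nat_neq_iff)
qed

text \<open>Ranks strictly increase along arcs, so a directed walk never returns to its start.\<close>

lemma orient_by_in_Acyc:
  assumes "pair_graph G" "inj_on r (pverts G)"
  shows "orient_by G r \<in> Acyc G"
proof -
  note o = orient_by_in_orientations[OF assms]
  interpret wf_digraph "with_proj (orient_by G r)"
    by (rule orientation_wf[OF assms(1) o])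
  have "r u < r v" if "(u, v) \<in> (parcs (orient_by G r))\<^sup>+" for u v
    using that by induction auto
  then have "(u, u) \<notin> (parcs (orient_by G r))\<^sup>+" for u
    by blast
  moreover have "\<exists>u. (u, u) \<in> (parcs (orient_by G r))\<^sup>+" if "cycle p" for p
  proof -
    from that obtain u where "awalk u p u" "p \<noteq> []"
      unfolding cycle_def by blast
    from reachable1_awalkI[OF this] show ?thesis by auto
  qed
  ultimately have "\<nexists>p. cycle p"
    by blast
  with o show ?thesis
    by (auto simp: Acyc_def)
qed

lemma Acyc_imp_acyclic:
  assumes "pair_graph G" "\<alpha> \<in> Acyc G"
  shows "acyclic (parcs \<alpha>)"
proof -
  interpret wf_digraph "with_proj \<alpha>"
    using orientation_wf assms by (auto simp: Acyc_def)
  show ?thesis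
  proof (rule acyclicI, intro allI notI)
    fix u assume "(u, u) \<in> (parcs \<alpha>)\<^sup>+"
    then have "u \<rightarrow>\<^sup>+\<^bsub>with_proj \<alpha>\<^esub> u" by simp
    then obtain p where "awalk u p u" "p \<noteq> []"
      unfolding reachable1_awalk by blast
    then have "closed_w p"
      by (auto simp: closed_w_def)
    then show False
      using closed_w_imp_cycle assms(2) by (auto simp: Acyc_def)
  qed
qed

text \<open>Topological sorting: a sink of \<open>r\<close> in \<open>A\<close> exists by acyclicity and receives the highest rank.\<close>

lemma acyclic_ranking_exists:
  fixes r :: "'a rel"
  assumes "finite A" "finite r" "acyclic r"
  shows "\<exists>f. bij_betw f A {1..card A} \<and> (\<forall>(u, v) \<in> r. u \<in> A \<longrightarrow> v \<in> A \<longrightarrow> f u < f v)"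
  using assms(1)
proof (induction A rule: finite_psubset_induct)
  case (psubset A)
  show ?case
  proof (cases "A = {}")
    case True
    then show ?thesis by (simp add: bij_betw_def)
  next
    case False
    have "wf (r\<inverse>)"
      using assms(2,3) by (rule finite_acyclic_wf_converse)
    then obtain m where m: "m \<in> A" "\<And>v. (m, v) \<in> r \<Longrightarrow> v \<notin> A"
      using False by (metis converseI wfE_min all_not_in_conv)
    then obtain f where f: "bij_betw f (A - {m}) {1..card (A - {m})}"
      "\<forall>(u, v) \<in> r. u \<in> A - {m} \<longrightarrow> v \<in> A - {m} \<longrightarrow> f u < f v"
      using psubset.IH[of "A - {m}"] by blast
    have c: "card A = Suc (card (A - {m}))"
      using m(1) psubset.hyps by (metis card.remove)
    define g where "g = f(m := card A)"
    have "bij_betw g (A - {m}) {1..card (A - {m})}"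
      using f(1) by (subst bij_betw_cong[of _ _ f]) (auto simp: g_def)
    then have "bij_betw g (insert m (A - {m})) (insert (card A) {1..card (A - {m})})"
      using bij_betw_combine[of g "A - {m}" "{1..card (A - {m})}" "{m}" "{card A}"] c
      by (simp add: g_def)
    moreover have "insert m (A - {m}) = A" "insert (card A) {1..card (A - {m})} = {1..card A}"
      using m(1) c by auto
    ultimately have b: "bij_betw g A {1..card A}" by simp
    have "g u < g v" if uv: "(u, v) \<in> r" "u \<in> A" "v \<in> A" for u v
    proof -
      have "u \<noteq> m" using uv m by blast
      then have "f u \<in> {1..card (A - {m})}"
        using f(1) uv(2) by (auto simp: bij_betw_def)
      then show ?thesis
        using uv f(2) \<open>u \<noteq> m\<close> c by (auto simp: g_def)
    qed
    with b show ?thesis by blast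
  qed
qed

section \<open>Linear extensions as fibres\<close>

lemma bijections_position:
  assumes "\<sigma> \<in> bijections A B"
  shows "inj_on (inv_into A \<sigma>) B"
    and "i \<in> A \<Longrightarrow> \<sigma> i \<in> B" "i \<in> A \<Longrightarrow> inv_into A \<sigma> (\<sigma> i) = i"
    and "v \<in> B \<Longrightarrow> inv_into A \<sigma> v \<in> A" "v \<in> B \<Longrightarrow> \<sigma> (inv_into A \<sigma> v) = v"
proof -
  have b: "bij_betw \<sigma> A B" using assms by (simp add: bijections_def)
  show "inj_on (inv_into A \<sigma>) B"
    using bij_betw_inv_into[OF b] by (simp add: bij_betw_def)
  show "i \<in> A \<Longrightarrow> \<sigma> i \<in> B" "i \<in> A \<Longrightarrow> inv_into A \<sigma> (\<sigma> i) = i"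
    "v \<in> B \<Longrightarrow> inv_into A \<sigma> v \<in> A" "v \<in> B \<Longrightarrow> \<sigma> (inv_into A \<sigma> v) = v"
    using b by (auto simp: bij_betw_def inv_into_into f_inv_into_f)
qed

text \<open>A linear extension of \<open>\<alpha>\<close> puts the tail of every arc of \<open>\<alpha>\<close> before its head. As an orientation
  decides the direction of every edge, this already determines \<open>\<alpha>\<close>.\<close>

lemma linear_extensions_eq_fibre:
  assumes G: "pair_graph G" "pverts G = {1..n}" and \<alpha>: "\<alpha> \<in> Acyc G"
  shows "linear_extensions n \<alpha> =
    {\<sigma> \<in> bijections {1..n} {1..n}. orient_by G (inv_into {1..n} \<sigma>) = \<alpha>}"
    (is "?L = ?R")
proof (intro equalityI subsetI)
  interpret G: pair_graph G by fact
  have o: "\<alpha> \<in> orientations G" using \<alpha> by (simp add: Acyc_def)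
  interpret wf_digraph "with_proj \<alpha>" by (rule orientation_wf[OF G(1) o])
  fix \<sigma>
  {
    assume L: "\<sigma> \<in> ?L"
    then have \<sigma>: "\<sigma> \<in> bijections {1..n} {1..n}" by (simp add: linear_extensions_def)
    have "inv_into {1..n} \<sigma> u < inv_into {1..n} \<sigma> v" if uv: "(u, v) \<in> parcs \<alpha>" for u v
    proof -
      have "u \<rightarrow>\<^sup>*\<^bsub>with_proj \<alpha>\<^esub> v" using uv by auto
      then have "inv_into {1..n} \<sigma> u \<le> inv_into {1..n} \<sigma> v"
        using L by (auto simp: linear_extensions_def)
      moreover have "(u, v) \<in> parcs G" using o uv by (auto simp: orientations_def)
      then have "u \<in> {1..n}" "v \<in> {1..n}" "u \<noteq> v"
        using G.wellformed'[of u v] G.pair_no_loops[of "(u, v)"] G(2) by auto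
      then have "inv_into {1..n} \<sigma> u \<noteq> inv_into {1..n} \<sigma> v"
        using bijections_position(1)[OF \<sigma>] by (auto dest: inj_onD)
      ultimately show ?thesis by simp
    qed
    then have "parcs \<alpha> \<subseteq> parcs (orient_by G (inv_into {1..n} \<sigma>))"
      using o by (auto simp: orientations_def)
    then have "\<alpha> = orient_by G (inv_into {1..n} \<sigma>)"
      using o orient_by_in_orientations[OF G(1)] bijections_position(1)[OF \<sigma>] G(2)
      by (intro orientation_eqI) auto
    with \<sigma> show "\<sigma> \<in> ?R" by simp
  next
    assume R: "\<sigma> \<in> ?R"
    have "inv_into {1..n} \<sigma> a \<le> inv_into {1..n} \<sigma> b" if "a \<rightarrow>\<^sup>*\<^bsub>with_proj \<alpha>\<^esub> b" for a b
      using that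
    proof (induction rule: reachable_induct)
      case (step y z)
      then have "(y, z) \<in> parcs \<alpha>" by simp
      then have "inv_into {1..n} \<sigma> y < inv_into {1..n} \<sigma> z"
        using R orient_by_simps(2)[of y z G "inv_into {1..n} \<sigma>"] by simp
      with step show ?case by simp
    qed simp
    with R show "\<sigma> \<in> ?L" by (simp add: linear_extensions_def)
  }
qed

lemma linear_extensions_nonempty:
  assumes G: "pair_graph G" "pverts G = {1..n}" and \<alpha>: "\<alpha> \<in> Acyc G"
  shows "linear_extensions n \<alpha> \<noteq> {}"
proof -
  interpret G: pair_graph G by fact
  have o: "\<alpha> \<in> orientations G" using \<alpha> by (simp add: Acyc_def)
  then have sub: "parcs \<alpha> \<subseteq> parcs G" by (simp add: orientations_def)
  obtain f where f: "bij_betw f {1..n} {1..n}"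
    "\<And>u v. (u, v) \<in> parcs \<alpha> \<Longrightarrow> u \<in> {1..n} \<Longrightarrow> v \<in> {1..n} \<Longrightarrow> f u < f v"
    using acyclic_ranking_exists[OF _ _ Acyc_imp_acyclic[OF G(1) \<alpha>], of "{1..n}"]
      finite_subset[OF sub G.pair_finite_arcs] by auto
  \<comment> \<open>The ranks are the places in the queue, so the permutation is the inverse of the ranking.\<close>
  define \<sigma> where "\<sigma> = restrict (inv_into {1..n} f) {1..n}"
  have \<sigma>: "\<sigma> \<in> bijections {1..n} {1..n}"
  proof -
    have "bij_betw \<sigma> {1..n} {1..n}"
      using bij_betw_inv_into[OF f(1)]
      by (rule iffD2[OF bij_betw_cong, rotated]) (simp add: \<sigma>_def)
    then show ?thesis by (simp add: bijections_def \<sigma>_def)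
  qed
  have "inv_into {1..n} \<sigma> v = f v" if "v \<in> {1..n}" for v
  proof -
    have "f v \<in> {1..n}" "\<sigma> (f v) = v"
      using f(1) that by (auto simp: bij_betw_def \<sigma>_def)
    then show ?thesis using bijections_position(3)[OF \<sigma>, of "f v"] by simp
  qed
  then have "parcs \<alpha> \<subseteq> parcs (orient_by G (inv_into {1..n} \<sigma>))"
    using sub f(2) G.wellformed' G(2) by auto
  then have "\<alpha> = orient_by G (inv_into {1..n} \<sigma>)"
    using o orient_by_in_orientations[OF G(1)] bijections_position(1)[OF \<sigma>] G(2)
    by (intro orientation_eqI) auto
  with \<sigma> show ?thesis
    unfolding linear_extensions_eq_fibre[OF assms] by auto
qed

section \<open>Exchanging neighbours in the queue\<close>

lemma inv_into_comp_transpose: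
  assumes \<sigma>: "\<sigma> \<in> bijections A B" and \<sigma>': "\<sigma>' \<in> bijections A B"
    and ab: "a \<in> A" "b \<in> A" and eq: "\<And>c. c \<in> A \<Longrightarrow> \<sigma>' c = \<sigma> (transpose a b c)"
    and v: "v \<in> B"
  shows "inv_into A \<sigma>' v = transpose a b (inv_into A \<sigma> v)"
proof -
  define i where "i = inv_into A \<sigma> v"
  have i: "i \<in> A" "\<sigma> i = v" using bijections_position[OF \<sigma>] v by (auto simp: i_def)
  have "transpose a b i \<in> A" using i ab by (auto simp: transpose_def)
  moreover have "\<sigma>' (transpose a b i) = v" using eq[OF calculation] i by simp
  ultimately show ?thesis using bijections_position(3)[OF \<sigma>', of "transpose a b i"] i_def by simp
qed

text \<open>Exchanging two consecutive places changes the relative order of their two occupants only, and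
  these are joined in \<open>Y\<close>, hence not in the complement.\<close>

lemma FS_path_arc_preserves:
  assumes Y: "pair_graph Y" "pverts Y = {1..n}"
    and arc: "(\<sigma>, \<sigma>') \<in> parcs (FS (path_graph n) Y)"
  shows "orient_by (complement_graph Y) (inv_into {1..n} \<sigma>) =
    orient_by (complement_graph Y) (inv_into {1..n} \<sigma>')"
proof -
  interpret Y: pair_graph Y by fact
  have "\<sigma> \<in> bijections {1..n} {1..n} \<and> \<sigma>' \<in> bijections {1..n} {1..n} \<and>
      (\<exists>a b. a \<in> {1..n} \<and> b \<in> {1..n} \<and> (b = a + 1 \<or> a = b + 1) \<and> (\<sigma> a, \<sigma> b) \<in> parcs Y \<and>
        \<sigma> a = \<sigma>' b \<and> \<sigma> b = \<sigma>' a \<and> (\<forall>c \<in> {1..n} - {a, b}. \<sigma> c = \<sigma>' c))"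
    using arc Y(2) by (simp add: FS_def path_graph_def conj_assoc)
  then obtain a b where \<sigma>: "\<sigma> \<in> bijections {1..n} {1..n}"
    and \<sigma>': "\<sigma>' \<in> bijections {1..n} {1..n}"
    and ab: "a \<in> {1..n}" "b \<in> {1..n}" "b = a + 1 \<or> a = b + 1"
    and e: "(\<sigma> a, \<sigma> b) \<in> parcs Y"
    and ex: "\<sigma> a = \<sigma>' b" "\<sigma> b = \<sigma>' a" "\<forall>c \<in> {1..n} - {a, b}. \<sigma> c = \<sigma>' c"
    by blast
  have "\<sigma>' c = \<sigma> (transpose a b c)" if "c \<in> {1..n}" for c
    using ex that by (auto simp: transpose_def)
  note pos = inv_into_comp_transpose[OF \<sigma> \<sigma>' ab(1,2) this]
  have "inv_into {1..n} \<sigma> u < inv_into {1..n} \<sigma> v \<longleftrightarrow>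
      inv_into {1..n} \<sigma>' u < inv_into {1..n} \<sigma>' v"
    if uv: "(u, v) \<in> parcs (complement_graph Y)" for u v
  proof -
    define i j where "i = inv_into {1..n} \<sigma> u" and "j = inv_into {1..n} \<sigma> v"
    have uv': "u \<in> {1..n}" "v \<in> {1..n}" "u \<noteq> v" "(u, v) \<notin> parcs Y"
      using uv Y(2) by (auto simp: complement_graph_def)
    then have ij: "\<sigma> i = u" "\<sigma> j = v"
      using bijections_position[OF \<sigma>] by (auto simp: i_def j_def)
    have "\<not> (i = a \<and> j = b)" "\<not> (i = b \<and> j = a)" "i \<noteq> j"
      using e uv' ij Y.arcs_symmetric by auto
    then have "i < j \<longleftrightarrow> transpose a b i < transpose a b j"
      using ab(3) by (auto simp: transpose_def)
    then show ?thesis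
      using pos uv' by (simp add: i_def j_def)
  qed
  then have "parcs (orient_by (complement_graph Y) (inv_into {1..n} \<sigma>)) =
      parcs (orient_by (complement_graph Y) (inv_into {1..n} \<sigma>'))"
    unfolding orient_by_def by auto
  then show ?thesis
    by (simp add: orient_by_def)
qed

lemma no_descent_imp_identity:
  fixes f :: "nat \<Rightarrow> nat"
  assumes "bij_betw f {1..n} {1..n}" "\<And>k. 1 \<le> k \<Longrightarrow> k < n \<Longrightarrow> f k \<le> f (Suc k)" "i \<in> {1..n}"
  shows "f i = i"
proof -
  have "map f [1..<Suc n] = [1..<Suc n]"
  proof (rule sorted_distinct_set_unique)
    show "sorted (map f [1..<Suc n])"
      using assms(2) by (auto simp: sorted_iff_nth_Suc simp del: upt_Suc)
    show "distinct (map f [1..<Suc n])"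
      using assms(1) by (auto simp: distinct_map bij_betw_def atLeastLessThanSuc_atLeastAtMost
          simp del: upt_Suc)
    show "set (map f [1..<Suc n]) = set [1..<Suc n]"
      using assms(1) by (auto simp: bij_betw_def atLeastLessThanSuc_atLeastAtMost
          simp del: upt_Suc)
  qed (simp_all del: upt_Suc)
  then have "map f [1..<Suc n] = map id [1..<Suc n]" by simp
  then show ?thesis using assms(3) unfolding map_eq_conv by (simp del: upt_Suc)
qed

text \<open>The weighted sum serves as termination measure for sorting: undoing a descent moves the
  larger value to the place with the smaller weight.\<close>

lemma exchange_decreases_weighted_sum:
  fixes f :: "nat \<Rightarrow> nat"
  assumes k: "1 \<le> k" "k < n" and descent: "f (Suc k) < f k"
  shows "(\<Sum>i\<in>{1..n}. (n - i) * f (transpose k (Suc k) i)) < (\<Sum>i\<in>{1..n}. (n - i) * f i)"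
proof -
  let ?C = "{1..n} - {k, Suc k}"
  have split: "(\<Sum>i\<in>{1..n}. g i) = g k + g (Suc k) + sum g ?C" for g :: "nat \<Rightarrow> nat"
  proof -
    have "{1..n} = insert k (insert (Suc k) ?C)" using k by auto
    then have "sum g {1..n} = sum g (insert k (insert (Suc k) ?C))" by presburger
    then show ?thesis by simp
  qed
  have rest: "(\<Sum>i\<in>?C. (n - i) * f (transpose k (Suc k) i)) = (\<Sum>i\<in>?C. (n - i) * f i)"
    by (rule sum.cong) (auto simp: transpose_def)
  obtain m where m: "n = Suc k + m" using k by (metis Suc_leI le_Suc_ex)
  have "(n - k) * f (Suc k) + (n - Suc k) * f k < (n - k) * f k + (n - Suc k) * f (Suc k)"
    using descent by (simp add: m algebra_simps)
  then show ?thesis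
    unfolding split rest by (simp add: transpose_def)
qed

text \<open>Bubble sort of \<open>\<sigma>\<close> into \<open>\<tau>\<close>. The places that \<open>\<tau>\<close> gives to \<open>\<sigma> 1, \<dots>, \<sigma> n\<close> form a permutation
  of \<open>{1..n}\<close>. If it has no descent, then \<open>\<sigma> = \<tau>\<close>. The occupants of a descent are ordered
  differently by \<open>\<sigma>\<close> and \<open>\<tau>\<close>, so the common orientation shows that they are adjacent in \<open>Y\<close>.\<close>

lemma same_orientation_imp_reachable:
  assumes Y: "pair_graph Y" "pverts Y = {1..n}"
    and "\<sigma> \<in> bijections {1..n} {1..n}" and \<tau>: "\<tau> \<in> bijections {1..n} {1..n}"
    and "orient_by (complement_graph Y) (inv_into {1..n} \<sigma>) =
      orient_by (complement_graph Y) (inv_into {1..n} \<tau>)"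
  shows "\<sigma> \<rightarrow>\<^sup>*\<^bsub>with_proj (FS (path_graph n) Y)\<^esub> \<tau>"
  using assms(3,5)
proof (induction "\<Sum>i\<in>{1..n}. (n - i) * inv_into {1..n} \<tau> (\<sigma> i)" arbitrary: \<sigma>
    rule: less_induct)
  case less
  interpret Y: pair_graph Y by fact
  interpret F: pair_graph "FS (path_graph n) Y"
    by (rule pair_graph_FS[OF pair_graph_path_graph Y(1)])
  note \<sigma> = less.prems(1)
  let ?f = "\<lambda>i. inv_into {1..n} \<tau> (\<sigma> i)"
  have verts: "pverts (FS (path_graph n) Y) = bijections {1..n} {1..n}"
    using Y(2) by (simp add: FS_def path_graph_def)
  show ?case
  proof (cases "\<exists>k. 1 \<le> k \<and> k < n \<and> ?f (Suc k) < ?f k")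
    case True
    then obtain k where k: "1 \<le> k" "k < n" "?f (Suc k) < ?f k" by blast
    then have kn: "k \<in> {1..n}" "Suc k \<in> {1..n}" by auto
    define \<sigma>' where "\<sigma>' = \<sigma> \<circ> transpose k (Suc k)"
    have \<sigma>': "\<sigma>' \<in> bijections {1..n} {1..n}"
    proof -
      have "bij_betw \<sigma>' {1..n} {1..n}"
        unfolding \<sigma>'_def using \<sigma> kn
        by (intro bij_betw_trans[of _ _ "{1..n}"]) (auto simp: bijections_def)
      moreover have "\<sigma>' \<in> extensional {1..n}"
        using \<sigma> kn by (auto simp: \<sigma>'_def bijections_def extensional_def transpose_def)
      ultimately show ?thesis by (simp add: bijections_def)
    qed
    have place: "inv_into {1..n} \<sigma> (\<sigma> k) = k" "inv_into {1..n} \<sigma> (\<sigma> (Suc k)) = Suc k"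
      and in_range: "\<sigma> k \<in> {1..n}" "\<sigma> (Suc k) \<in> {1..n}"
      using bijections_position(2,3)[OF \<sigma>] kn by auto
    have "\<sigma> k \<noteq> \<sigma> (Suc k)" using place by force
    moreover have "(\<sigma> k, \<sigma> (Suc k)) \<notin> parcs (complement_graph Y)"
    proof
      assume "(\<sigma> k, \<sigma> (Suc k)) \<in> parcs (complement_graph Y)"
      then have "(\<sigma> k, \<sigma> (Suc k)) \<in> parcs (orient_by (complement_graph Y) (inv_into {1..n} \<sigma>))"
        using place by simp
      then show False
        unfolding less.prems(2) using k(3) by simp
    qed
    ultimately have "(\<sigma> k, \<sigma> (Suc k)) \<in> parcs Y"
      using in_range Y(2) by (simp add: complement_graph_def)
    then have "(k, Suc k) \<in> parcs (path_graph n) \<and> (\<sigma> k, \<sigma> (Suc k)) \<in> parcs Y \<and>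
        \<sigma> k = \<sigma>' (Suc k) \<and> \<sigma> (Suc k) = \<sigma>' k \<and>
        (\<forall>c \<in> pverts (path_graph n) - {k, Suc k}. \<sigma> c = \<sigma>' c)"
      using kn by (simp add: path_graph_def \<sigma>'_def)
    then have "\<exists>a b. (a, b) \<in> parcs (path_graph n) \<and> (\<sigma> a, \<sigma> b) \<in> parcs Y \<and>
        \<sigma> a = \<sigma>' b \<and> \<sigma> b = \<sigma>' a \<and>
        (\<forall>c \<in> pverts (path_graph n) - {a, b}. \<sigma> c = \<sigma>' c)"
      by blast
    then have arc: "(\<sigma>, \<sigma>') \<in> parcs (FS (path_graph n) Y)"
      using \<sigma> \<sigma>' verts by (simp add: FS_def)
    have "\<sigma>' \<rightarrow>\<^sup>*\<^bsub>with_proj (FS (path_graph n) Y)\<^esub> \<tau>"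
    proof (rule less.hyps[OF _ \<sigma>'])
      show "(\<Sum>i\<in>{1..n}. (n - i) * inv_into {1..n} \<tau> (\<sigma>' i)) < (\<Sum>i\<in>{1..n}. (n - i) * ?f i)"
        using exchange_decreases_weighted_sum[OF k] by (simp add: \<sigma>'_def)
      show "orient_by (complement_graph Y) (inv_into {1..n} \<sigma>') =
          orient_by (complement_graph Y) (inv_into {1..n} \<tau>)"
        using FS_path_arc_preserves[OF Y arc] less.prems(2) by simp
    qed
    with arc show ?thesis
      by (intro F.adj_reachable_trans[of \<sigma> \<sigma>']) simp_all
  next
    case False
    have "bij_betw ?f {1..n} {1..n}"
      using bij_betw_trans[OF _ bij_betw_inv_into, of \<sigma> "{1..n}" "{1..n}" \<tau> "{1..n}"] \<sigma> \<tau>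
      by (simp add: bijections_def comp_def)
    then have "?f i = i" if "i \<in> {1..n}" for i
      by (rule no_descent_imp_identity) (use False that in \<open>auto simp: not_less\<close>)
    then have "\<sigma> i = \<tau> i" if "i \<in> {1..n}" for i
      using bijections_position(2)[OF \<sigma>, of i] bijections_position(5)[OF \<tau>, of "\<sigma> i"] that
      by simp
    then have "\<sigma> = \<tau>"
      using \<sigma> \<tau> by (auto simp: bijections_def intro: extensionalityI)
    then show ?thesis
      using \<tau> verts by simp
  qed
qed

section \<open>Components of the friends-and-strangers graph of a path\<close>

lemma component_eq_fibre:
  assumes Y: "pair_graph Y" "pverts Y = {1..n}" and \<sigma>: "\<sigma> \<in> bijections {1..n} {1..n}"
  shows "pre_digraph.scc_of (with_proj (FS (path_graph n) Y)) \<sigma> =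
    {\<tau> \<in> bijections {1..n} {1..n}. orient_by (complement_graph Y) (inv_into {1..n} \<tau>) =
       orient_by (complement_graph Y) (inv_into {1..n} \<sigma>)}"
    (is "?S = ?R")
proof (intro equalityI subsetI)
  interpret F: pair_graph "FS (path_graph n) Y"
    by (rule pair_graph_FS[OF pair_graph_path_graph Y(1)])
  have verts: "pverts (FS (path_graph n) Y) = bijections {1..n} {1..n}"
    using Y(2) by (simp add: FS_def path_graph_def)
  fix \<tau>
  {
    assume "\<tau> \<in> ?S"
    then have r: "\<sigma> \<rightarrow>\<^sup>*\<^bsub>with_proj (FS (path_graph n) Y)\<^esub> \<tau>"
      by (simp add: F.scc_of_def)
    then have "orient_by (complement_graph Y) (inv_into {1..n} \<tau>) =
        orient_by (complement_graph Y) (inv_into {1..n} \<sigma>)"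
      by (induction rule: F.reachable_induct) (auto dest: FS_path_arc_preserves[OF Y])
    then show "\<tau> \<in> ?R"
      using F.reachable_in_verts[OF r] verts by simp
  next
    assume "\<tau> \<in> ?R"
    then show "\<tau> \<in> ?S"
      using same_orientation_imp_reachable[OF Y _ \<sigma>, of \<tau>] F.scc_ofI_reachable by auto
  }
qed

theorem theorem3p1:
  fixes n :: nat and Y :: "nat pair_pre_digraph"
  assumes "pair_graph Y" and "pverts Y = {1..n}"
  shows "(\<forall>\<alpha> \<in> Acyc (complement_graph Y). linear_extensions n \<alpha> \<noteq> {}) \<and>
    (\<forall>\<sigma>. (\<forall>\<alpha> \<in> Acyc (complement_graph Y). \<sigma> \<alpha> \<in> linear_extensions n \<alpha>) \<longrightarrow>
      (let F = FS (path_graph n) Y; H = (\<lambda>\<alpha>. component_of F (\<sigma> \<alpha>)) in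
        (\<forall>\<alpha> \<in> Acyc (complement_graph Y).
           (\<forall>\<tau> \<in> linear_extensions n \<alpha>. component_of F \<tau> = H \<alpha>) \<and>
           verts (H \<alpha>) = linear_extensions n \<alpha>) \<and>
        is_disjoint_union (with_proj F) (Acyc (complement_graph Y)) H))"
proof -
  let ?G = "complement_graph Y"
  let ?F = "FS (path_graph n) Y"
  have G: "pair_graph ?G" "pverts ?G = {1..n}"
    using pair_graph_complement_graph[OF assms(1)] assms(2) by (simp, simp add: complement_graph_def)
  interpret F: pair_graph ?F
    by (rule pair_graph_FS[OF pair_graph_path_graph assms(1)])
  have verts: "pverts ?F = bijections {1..n} {1..n}"
    using assms(2) by (simp add: FS_def path_graph_def)
  note L = linear_extensions_eq_fibre[OF G]
  have scc: "F.scc_of \<tau> = linear_extensions n \<alpha>"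
    if "\<alpha> \<in> Acyc ?G" "\<tau> \<in> linear_extensions n \<alpha>" for \<alpha> \<tau>
    using that component_eq_fibre[OF assms] by (auto simp: L)
  have main: "(\<forall>\<alpha> \<in> Acyc ?G. (\<forall>\<tau> \<in> linear_extensions n \<alpha>. component_of ?F \<tau> = component_of ?F (\<sigma> \<alpha>)) \<and>
      verts (component_of ?F (\<sigma> \<alpha>)) = linear_extensions n \<alpha>) \<and>
      is_disjoint_union (with_proj ?F) (Acyc ?G) (\<lambda>\<alpha>. component_of ?F (\<sigma> \<alpha>))"
    if \<sigma>: "\<forall>\<alpha> \<in> Acyc ?G. \<sigma> \<alpha> \<in> linear_extensions n \<alpha>" for \<sigma>
  proof -
    let ?H = "\<lambda>\<alpha>. component_of ?F (\<sigma> \<alpha>)"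
    have H: "component_of ?F \<tau> = ?H \<alpha>" if "\<alpha> \<in> Acyc ?G" "\<tau> \<in> linear_extensions n \<alpha>" for \<alpha> \<tau>
      using scc[of \<alpha>] that \<sigma> by (simp add: component_of_def)
    have vH: "verts (?H \<alpha>) = linear_extensions n \<alpha>" if "\<alpha> \<in> Acyc ?G" for \<alpha>
      using scc[of \<alpha> "\<sigma> \<alpha>"] that \<sigma> by (simp add: component_of_def)
    have sccs: "?H ` Acyc ?G = F.sccs"
    proof -
      have "?H ` Acyc ?G = component_of ?F ` bijections {1..n} {1..n}"
      proof (intro equalityI subsetI)
        fix C assume "C \<in> ?H ` Acyc ?G"
        then show "C \<in> component_of ?F ` bijections {1..n} {1..n}"
          using \<sigma> by (auto simp: L)
      next
        fix C assume "C \<in> component_of ?F ` bijections {1..n} {1..n}"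
        then obtain \<tau> where \<tau>: "\<tau> \<in> bijections {1..n} {1..n}" "C = component_of ?F \<tau>" by blast
        \<comment> \<open>Every permutation extends the orientation that it induces, so no component is missed.\<close>
        let ?\<alpha> = "orient_by ?G (inv_into {1..n} \<tau>)"
        have "?\<alpha> \<in> Acyc ?G"
          using orient_by_in_Acyc[OF G(1)] bijections_position(1)[OF \<tau>(1)] G(2) by simp
        with \<tau> show "C \<in> ?H ` Acyc ?G"
          using H[of ?\<alpha> \<tau>] by (auto simp: L)
      qed
      also have "\<dots> = F.sccs"
        unfolding F.sccs_conv_sccs_verts F.sccs_verts_conv_scc_of image_image component_of_def
        by (simp add: verts)
      finally show ?thesis .
    qed
    have "subgraph (?H \<alpha>) (with_proj ?F)" if "\<alpha> \<in> Acyc ?G" for \<alpha>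
      using sccs that F.in_sccs_imp_induced by blast
    moreover have "disjoint_family_on (\<lambda>\<alpha>. verts (?H \<alpha>)) (Acyc ?G)"
      by (auto simp: disjoint_family_on_def vH L)
    moreover have "with_proj ?F = F.Union (?H ` Acyc ?G)"
      using sccs F.graph_is_union_sccs by simp
    ultimately have "is_disjoint_union (with_proj ?F) (Acyc ?G) ?H"
      unfolding is_disjoint_union_def by blast
    then show ?thesis
      by (intro conjI ballI) (rule H vH; assumption)+
  qed
  then show ?thesis
    using linear_extensions_nonempty[OF G] unfolding Let_def by blast
qed

end
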